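(* If $C^\pi \leq c \cdot \mathrm{OPT}$, then $C^{\pi_\text{out}} \leq (1+\rho) \cdot c \cdot \mathrm{OPT}$, for any $\rho \geq \sqrt{2}$.
   Context: Original problem: a single machine must process jobs $\mathcal{J}$; each job $j$ has a weight $w(j)\ge0$ and is a set of operations, each operation $o$ with processing time $p(o)\ge0$ and family $f(o)\in\{f_1,\dots,f_K\}$. A setup of length $s(f)$ is required before the first operation if it is of family $f$ and whenever the machine switches to an operation of a different family $f$. A job completes when its last operation completes; the objective is the total weighted completion time. $\mathrm{OPT}$ denotes the optimal value of this original problem. One-time setup problem (a relaxation): for each family $f$ a setup operation $o^s_f$ with processing time $s(f)$ and weight $0$ must be processed at some time before every operation of family $f$; the completion time of an operation is the sum of processing times of it and all operations (including setup operations) before it. Jobs are assumed glued (all operations of a job processed consecutively). $\pi$ is a schedule for this relaxed problem with total weighted completion time $C^\pi$ (measured in the relaxed cost model). \textsc{Transform} produces $\pi_\text{out}$: start with the sequence of non-setup operations induced by $\pi$; a batch is a maximal run of consecutive operations of the same family. Iterating over batches $B_1,B_2,\dots$ in order, for batch $B_i$ of family $f$ move as many operations of family $f$ as possible from the closest later batches into $B_i$ while ensuring $p(B_i)<\rho\cdot s(f)$, where $\rho$ is a fixed constant (pull factor) and $p(B_i)$ is the total processing time of $B_i$; batches that become empty are removed. $C^{\pi_\text{out}}$ is the total weighted completion time of $\pi_\text{out}$ in the original cost model (with setups at every family change). *)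

theory Defs
  imports Complex_Main "HOL-Library.Disjoint_Sets"
begin

record ('o, 'f) setup_instance =
  jobs :: "'o set set"
  families :: "'f set"
  weight :: "'o set \<Rightarrow> real"
  ptime :: "'o \<Rightarrow> real"
  family :: "'o \<Rightarrow> 'f"
  setup_time :: "'f \<Rightarrow> real"

definition operations :: "('o, 'f) setup_instance \<Rightarrow> 'o set" where
  "operations I = \<Union> (jobs I)"

definition valid_instance :: "('o, 'f) setup_instance \<Rightarrow> bool" where
  "valid_instance I \<longleftrightarrow>
     finite (operations I) \<and> partition_on (operations I) (jobs I) \<and>
     finite (families I) \<and>
     (\<forall>j\<in>jobs I. 0 \<le> weight I j) \<and>
     (\<forall>a\<in>operations I. 0 \<le> ptime I a \<and> family I a \<in> families I) \<and>
     (\<forall>f\<in>families I. 0 \<le> setup_time I f)"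

text \<open>The initial segment of a list up to and including the (first) occurrence of an element.\<close>

definition upto_elem :: "'a \<Rightarrow> 'a list \<Rightarrow> 'a list" where
  "upto_elem x xs = takeWhile (\<lambda>y. y \<noteq> x) xs @ [x]"

subsection \<open>The original problem\<close>

text \<open>A schedule is a sequence of all operations. Setups are implicit: they are paid for whenever
  the family differs from that of the preceding operation, which is \<open>None\<close> at the very start.\<close>

definition schedule :: "('o, 'f) setup_instance \<Rightarrow> 'o list \<Rightarrow> bool" where
  "schedule I xs \<longleftrightarrow> distinct xs \<and> set xs = operations I"

fun elapsed :: "('o, 'f) setup_instance \<Rightarrow> 'f option \<Rightarrow> 'o list \<Rightarrow> real" where
  "elapsed I prev [] = 0"
| "elapsed I prev (x # xs) =
     (if prev = Some (family I x) then 0 else setup_time I (family I x)) + ptime I x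
     + elapsed I (Some (family I x)) xs"

definition completion :: "('o, 'f) setup_instance \<Rightarrow> 'o list \<Rightarrow> 'o \<Rightarrow> real" where
  "completion I xs a = elapsed I None (upto_elem a xs)"

definition cost :: "('o, 'f) setup_instance \<Rightarrow> 'o list \<Rightarrow> real" where
  "cost I xs = (\<Sum>j\<in>jobs I. weight I j * Max (completion I xs ` j))"

definition OPT :: "('o, 'f) setup_instance \<Rightarrow> real" where
  "OPT I = Min (cost I ` {xs. schedule I xs})"

subsection \<open>The one-time setup problem\<close>

datatype ('o, 'f) item = Op 'o | Setup 'f

primrec item_time :: "('o, 'f) setup_instance \<Rightarrow> ('o, 'f) item \<Rightarrow> real" where
  "item_time I (Op a) = ptime I a"
| "item_time I (Setup f) = setup_time I f"

definition glued :: "('o, 'f) setup_instance \<Rightarrow> ('o, 'f) item list \<Rightarrow> bool" where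
  "glued I \<pi> \<longleftrightarrow> (\<forall>j\<in>jobs I. \<exists>us vs ws. \<pi> = us @ vs @ ws \<and> set vs = Op ` j)"

definition relaxed_schedule :: "('o, 'f) setup_instance \<Rightarrow> ('o, 'f) item list \<Rightarrow> bool" where
  "relaxed_schedule I \<pi> \<longleftrightarrow>
     distinct \<pi> \<and> set \<pi> = Op ` operations I \<union> Setup ` families I \<and>
     (\<forall>a\<in>operations I. Setup (family I a) \<in> set (upto_elem (Op a) \<pi>)) \<and>
     glued I \<pi>"

definition relaxed_completion ::
    "('o, 'f) setup_instance \<Rightarrow> ('o, 'f) item list \<Rightarrow> 'o \<Rightarrow> real" where
  "relaxed_completion I \<pi> a = sum_list (map (item_time I) (upto_elem (Op a) \<pi>))"

text \<open>Setup operations have weight 0 and hence do not occur in the sum.\<close>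

definition relaxed_cost :: "('o, 'f) setup_instance \<Rightarrow> ('o, 'f) item list \<Rightarrow> real" where
  "relaxed_cost I \<pi> = (\<Sum>j\<in>jobs I. weight I j * Max (relaxed_completion I \<pi> ` j))"

subsection \<open>From relaxed schedules to schedules\<close>

fun induced_ops :: "('o, 'f) item list \<Rightarrow> 'o list" where
  "induced_ops [] = []"
| "induced_ops (Op a # \<pi>) = a # induced_ops \<pi>"
| "induced_ops (Setup f # \<pi>) = induced_ops \<pi>"

text \<open>Given a batch of family \<open>f\<close> with total processing time \<open>L\<close> and the sequence behind it,
  \<open>pull\<close> returns the operations moved into the batch and the remaining sequence. Operations of
  family \<open>f\<close> are taken in sequence order, and pulling stops at the first one that does not fit:
  it is not skipped in favour of one from farther away.\<close>

fun pull :: "('o, 'f) setup_instance \<Rightarrow> real \<Rightarrow> 'f \<Rightarrow> real \<Rightarrow> 'o list \<Rightarrow> 'o list \<times> 'o list" where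
  "pull I \<rho> f L [] = ([], [])"
| "pull I \<rho> f L (y # ys) =
     (if family I y \<noteq> f then
        (let (Q, R) = pull I \<rho> f L ys in (Q, y # R))
      else if L + ptime I y < \<rho> * setup_time I f then
        (let (Q, R) = pull I \<rho> f (L + ptime I y) ys in (y # Q, R))
      else ([], y # ys))"

lemma length_pull: "length (snd (pull I \<rho> f L ys)) \<le> length ys"
  by (induction I \<rho> f L ys rule: pull.induct) (auto simp: Let_def split: prod.splits)

text \<open>Batches are maximal runs of the current sequence throughout: if a batch is emptied and its
  two neighbours belong to the same family, they become a single batch. An already processed
  batch never grows this way, because the operation following it is not of its family.\<close>

function transform :: "('o, 'f) setup_instance \<Rightarrow> real \<Rightarrow> 'o list \<Rightarrow> 'o list" where
  "transform I \<rho> [] = []"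
| "transform I \<rho> (x # xs) =
     (let f = family I x;
          B = takeWhile (\<lambda>y. family I y = f) (x # xs);
          R = dropWhile (\<lambda>y. family I y = f) (x # xs);
          Q = pull I \<rho> f (sum_list (map (ptime I) B)) R
      in B @ fst Q @ transform I \<rho> (snd Q))"
  by pat_completeness auto
termination
proof (relation "measure (\<lambda>(I, \<rho>, xs). length xs)")
  show "wf (measure (\<lambda>(I, \<rho>, xs). length xs))" by simp
next
  fix I :: "('o, 'f) setup_instance" and \<rho> :: real and x xs f B R Q
  assume "f = family I x"
    and "R = dropWhile (\<lambda>y. family I y = f) (x # xs)"
    and "Q = pull I \<rho> f (sum_list (map (ptime I) B)) R"
  then have "length (snd Q) \<le> length (dropWhile (\<lambda>y. family I y = f) xs)"
    using length_pull by force
  also have "\<dots> \<le> length xs" by (rule length_dropWhile_le)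
  finally show "((I, \<rho>, snd Q), (I, \<rho>, x # xs)) \<in> measure (\<lambda>(I, \<rho>, xs). length xs)"
    by simp
qed

definition Transform :: "('o, 'f) setup_instance \<Rightarrow> real \<Rightarrow> ('o, 'f) item list \<Rightarrow> 'o list" where
  "Transform I \<rho> \<pi> = transform I \<rho> (induced_ops \<pi>)"

end

theory Submission
  imports Defs
begin

text \<open>
  The bound holds for every operation \<open>a\<close> separately, and family by family. Pulling never
  reorders operations of the same family, so each family \<open>f\<close> has at most one batch before \<open>a\<close> in
  the output that contains operations from behind \<open>a\<close>: its last one, which then is shorter than
  \<open>\<rho> * s f\<close>. Every earlier batch of \<open>f\<close>, together with the first operation of the next batch of
  \<open>f\<close>, takes time at least \<open>\<rho> * s f\<close>. If \<open>T\<close> is the total time of the operations of \<open>f\<close> up to \<open>a\<close>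
  in the input, the number \<open>k\<close> of setups of \<open>f\<close> therefore satisfies \<open>(k - 1) * \<rho> * s f \<le> 2 * T\<close>,
  and \<open>\<rho>\<^sup>2 \<ge> 2\<close> gives \<open>k * s f + T + \<rho> * s f \<le> (1 + \<rho>) * (s f + T)\<close>.
\<close>

section \<open>Initial segments up to an element\<close>

lemma upto_elem_Nil [simp]: "upto_elem x [] = [x]"
  by (simp add: upto_elem_def)

lemma upto_elem_Cons [simp]:
  "upto_elem x (y # ys) = (if y = x then [x] else y # upto_elem x ys)"
  by (simp add: upto_elem_def)

lemma upto_elem_append:
  "upto_elem x (xs @ ys) = (if x \<in> set xs then upto_elem x xs else xs @ upto_elem x ys)"
  by (induction xs) auto

lemma set_upto_elem: "x \<in> set xs \<Longrightarrow> set (upto_elem x xs) \<subseteq> set xs"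
  by (induction xs) auto

lemma distinct_upto_elem: "distinct xs \<Longrightarrow> distinct (upto_elem x xs)"
  by (auto simp: upto_elem_def dest: set_takeWhileD)

lemma set_upto_elem_mono:
  "y \<in> set (upto_elem x xs) \<Longrightarrow> set (upto_elem y xs) \<subseteq> set (upto_elem x xs)"
  by (induction xs) (auto split: if_splits)

lemma upto_elem_filter: "P x \<Longrightarrow> upto_elem x (filter P xs) = filter P (upto_elem x xs)"
  by (induction xs) auto

subsection \<open>The pulling step\<close>

definition family_ops :: "('o, 'f) setup_instance \<Rightarrow> 'f \<Rightarrow> 'o list \<Rightarrow> 'o list" where
  "family_ops I f xs = filter (\<lambda>y. family I y = f) xs"

lemma family_ops_simps [simp]:
  "family_ops I f [] = []"
  "family_ops I f (x # xs) = (if family I x = f then x # family_ops I f xs else family_ops I f xs)"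
  "family_ops I f (xs @ ys) = family_ops I f xs @ family_ops I f ys"
  by (simp_all add: family_ops_def)

lemma set_family_ops: "set (family_ops I f xs) = {x \<in> set xs. family I x = f}"
  by (auto simp: family_ops_def)

lemma family_ops_all: "\<forall>x\<in>set xs. family I x = f \<Longrightarrow> family_ops I f xs = xs"
  by (simp add: family_ops_def)

lemma family_ops_none: "\<forall>x\<in>set xs. family I x \<noteq> f \<Longrightarrow> family_ops I f xs = []"
  by (simp add: family_ops_def)

lemma family_ops_upto_elem:
  "upto_elem x (family_ops I (family I x) xs) = family_ops I (family I x) (upto_elem x xs)"
  unfolding family_ops_def by (rule upto_elem_filter) simp

text \<open>Unlike in \<open>pull.induct\<close>, the result \<open>(Q, R)\<close> is a parameter of
  the property, so no proof has to split pairs. The case \<open>stop\<close> has no induction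
  hypothesis because the rest is returned untouched.\<close>

lemma pull_induct [consumes 1, case_names Nil skip take stop]:
  assumes "pull I \<rho> f L ys = (Q, R)"
    and "\<And>L. P L [] [] []"
    and "\<And>L y ys Q R. family I y \<noteq> f \<Longrightarrow> pull I \<rho> f L ys = (Q, R) \<Longrightarrow> P L ys Q R \<Longrightarrow>
      P L (y # ys) Q (y # R)"
    and "\<And>L y ys Q R. family I y = f \<Longrightarrow> L + ptime I y < \<rho> * setup_time I f \<Longrightarrow>
      pull I \<rho> f (L + ptime I y) ys = (Q, R) \<Longrightarrow> P (L + ptime I y) ys Q R \<Longrightarrow>
      P L (y # ys) (y # Q) R"
    and "\<And>L y ys. family I y = f \<Longrightarrow> \<not> L + ptime I y < \<rho> * setup_time I f \<Longrightarrow>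
      P L (y # ys) [] (y # ys)"
  shows "P L ys Q R"
  using assms(1)
proof (induction ys arbitrary: L Q R)
  case Nil
  then show ?case using assms(2) by simp
next
  case (Cons y ys)
  consider (skip) "family I y \<noteq> f"
    | (take) "family I y = f" "L + ptime I y < \<rho> * setup_time I f"
    | (stop) "family I y = f" "\<not> L + ptime I y < \<rho> * setup_time I f"
    by blast
  then show ?case
  proof cases
    case skip
    obtain Q' R' where p: "pull I \<rho> f L ys = (Q', R')" by fastforce
    then show ?thesis using Cons.prems assms(3)[OF skip p Cons.IH[OF p]] skip by simp
  next
    case take
    obtain Q' R' where p: "pull I \<rho> f (L + ptime I y) ys = (Q', R')" by fastforce
    then show ?thesis using Cons.prems assms(4)[OF take p Cons.IH[OF p]] take by simp
  next
    case stop
    then show ?thesis using Cons.prems assms(5)[OF stop, of ys] by auto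
  qed
qed

lemma pull_family: "pull I \<rho> f L ys = (Q, R) \<Longrightarrow> \<forall>x\<in>set Q. family I x = f"
  by (induction rule: pull_induct) auto

lemma pull_set: "pull I \<rho> f L ys = (Q, R) \<Longrightarrow> set ys = set Q \<union> set R"
  by (induction rule: pull_induct) auto

lemma pull_distinct: "pull I \<rho> f L ys = (Q, R) \<Longrightarrow> distinct ys \<Longrightarrow> distinct R"
  by (induction rule: pull_induct) (auto dest: pull_set)

text \<open>Pulling goes in sequence order and stops at the first operation that does not fit, so
  the order within family \<open>f\<close> survives.\<close>

lemma pull_family_ops: "pull I \<rho> f L ys = (Q, R) \<Longrightarrow> family_ops I f ys = Q @ family_ops I f R"
  by (induction rule: pull_induct) auto

text \<open>The case \<open>Q = []\<close> is separate because the batch may exceed the limit before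
  anything is pulled.\<close>

lemma pull_bound:
  "pull I \<rho> f L ys = (Q, R) \<Longrightarrow>
     Q = [] \<or> L + sum_list (map (ptime I) Q) < \<rho> * setup_time I f"
  by (induction rule: pull_induct) (auto simp: add.assoc)

text \<open>Only operations of family \<open>f\<close> are removed, and by distinctness
  \<open>a\<close> is not one of them, so the cut at \<open>a\<close> stays in place.\<close>

lemma pull_upto_other:
  "pull I \<rho> f L ys = (Q, R) \<Longrightarrow> a \<in> set R \<Longrightarrow> distinct ys \<Longrightarrow> g \<noteq> f \<Longrightarrow>
     family_ops I g (upto_elem a R) = family_ops I g (upto_elem a ys)"
  by (induction rule: pull_induct) (auto dest: pull_set)

text \<open>An operation of family \<open>f\<close> left over at or before \<open>a\<close> shows
  that pulling stopped without passing \<open>a\<close>. Hence all of \<open>Q\<close> comes from in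
  front of \<open>a\<close>, and the first leftover is the operation that did not fit.\<close>

lemma pull_upto_same:
  assumes "pull I \<rho> f L ys = (Q, R)" "a \<in> set R" "distinct ys"
    and "family_ops I f (upto_elem a R) \<noteq> []"
  shows "family_ops I f (upto_elem a ys) = Q @ family_ops I f (upto_elem a R) \<and>
     \<rho> * setup_time I f \<le> L + sum_list (map (ptime I) Q)
       + ptime I (hd (family_ops I f (upto_elem a R)))"
  using assms
proof (induction rule: pull_induct)
  case (skip L y ys Q R)
  then show ?case by (auto split: if_splits)
next
  case (take L y ys Q R)
  have "y \<noteq> a" using pull_set[OF take(3)] take by auto
  then show ?case using take by (auto simp: add.assoc)
qed auto

subsection \<open>The amortised bound\<close>

text \<open>The summand \<open>- \<rho> / 2 * t\<close>, with \<open>t\<close> the time of the first operation, makes the bound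
  inductive over the batches of a family: when a batch of length \<open>p\<close> starting with \<open>t \<le> p\<close> is
  followed by one starting with \<open>t'\<close>, it frees \<open>\<rho> / 2 * (p + t') \<ge> \<rho>\<^sup>2 / 2 * s \<ge> s\<close> for the setup.\<close>

fun potential :: "real \<Rightarrow> real \<Rightarrow> real list \<Rightarrow> real" where
  "potential \<rho> s [] = 0"
| "potential \<rho> s (t # ts) = (1 + \<rho>) * (s + t + sum_list ts) - \<rho> / 2 * t"

text \<open>Serves the last batch of a family up to \<open>a\<close>: \<open>s\<close> pays for its
  setup and \<open>\<rho> * s\<close> for operations pulled from behind \<open>a\<close>.\<close>

lemma potential_batch:
  assumes "ts \<noteq> []" "\<forall>t\<in>set ts. 0 \<le> t" "0 \<le> \<rho>"
  shows "s * (1 + \<rho>) + sum_list ts \<le> potential \<rho> s ts"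
proof (cases ts)
  case (Cons t us)
  have "0 \<le> sum_list us" using assms Cons by (auto intro: sum_list_nonneg)
  moreover have "0 \<le> t" using assms Cons by simp
  ultimately have "0 \<le> \<rho> * (t / 2 + sum_list us)" using assms by simp
  then show ?thesis using Cons by (simp add: algebra_simps)
qed (use assms in simp)

lemma potential_append:
  assumes "ts \<noteq> []" "us \<noteq> []" "\<forall>t\<in>set ts. 0 \<le> t" "sqrt 2 \<le> \<rho>" "0 \<le> s"
    and "\<rho> * s \<le> sum_list ts + hd us"
  shows "s + sum_list ts + potential \<rho> s us \<le> potential \<rho> s (ts @ us)"
proof -
  obtain t ts' where t: "ts = t # ts'" using assms(1) by (cases ts) auto
  obtain u us' where u: "us = u # us'" using assms(2) by (cases us) auto
  have "0 \<le> sqrt (2::real)" by simp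
  then have rho: "0 \<le> \<rho>" using assms(4) by linarith
  have "2 \<le> \<rho> * \<rho>" using mult_mono[OF assms(4,4) rho] by simp
  then have "2 * s \<le> (\<rho> * \<rho>) * s" using assms(5) by (rule mult_right_mono)
  also have "\<dots> \<le> \<rho> * (t + sum_list ts' + u)"
    using mult_left_mono[OF assms(6) rho] t u by (simp add: mult.assoc)
  finally have "2 * s \<le> \<rho> * (t + sum_list ts' + u)" .
  \<comment> \<open>Before \<open>s\<close> is charged, the gain is exactly
    \<open>\<rho> / 2 * (t + 2 * sum_list ts' + u)\<close>. The previous bound uses one copy of
    \<open>sum_list ts'\<close>; the other is dropped as nonnegative.\<close>
  moreover have "0 \<le> \<rho> * sum_list ts'"
    using assms(3) t rho by (auto intro!: mult_nonneg_nonneg sum_list_nonneg)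
  ultimately show ?thesis using t u by (simp add: algebra_simps)
qed

definition total_potential :: "('o, 'f) setup_instance \<Rightarrow> real \<Rightarrow> 'o list \<Rightarrow> real" where
  "total_potential I \<rho> xs =
     (\<Sum>f\<in>families I. potential \<rho> (setup_time I f) (map (ptime I) (family_ops I f xs)))"

lemma potential_nonneg:
  assumes "\<forall>t\<in>set ts. 0 \<le> t" "0 \<le> \<rho>" "0 \<le> s"
  shows "0 \<le> potential \<rho> s ts"
proof (cases "ts = []")
  case False
  have "0 \<le> s * (1 + \<rho>) + sum_list ts" using assms by (simp add: sum_list_nonneg)
  then show ?thesis using potential_batch[OF False assms(1,2), of s] by linarith
qed simp

text \<open>The setup is charged even if \<open>prev = Some f\<close>, which makes the bound
  independent of \<open>prev\<close>.\<close>

lemma elapsed_batch: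
  assumes "\<forall>y\<in>set B. family I y = f" "B \<noteq> []" "0 \<le> setup_time I f"
  shows "elapsed I prev (B @ ys) \<le>
    setup_time I f + sum_list (map (ptime I) B) + elapsed I (Some f) ys"
proof -
  have *: "elapsed I (Some f) (C @ ys) = sum_list (map (ptime I) C) + elapsed I (Some f) ys"
    if "\<forall>y\<in>set C. family I y = f" for C
    using that by (induction C) auto
  show ?thesis using assms * by (cases B) auto
qed

text \<open>The induction follows the recursion of \<open>transform\<close>, one output batch per
  step. \<open>prev\<close> is arbitrary because the recursive call starts right after a batch of
  family \<open>f\<close>. As long as \<open>a\<close> is not reached, a step changes the potential
  of \<open>f\<close> only.\<close>

lemma elapsed_transform_le:
  assumes "sqrt 2 \<le> \<rho>" "finite (families I)" "\<forall>f\<in>families I. 0 \<le> setup_time I f"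
    and "\<forall>y\<in>set xs. 0 \<le> ptime I y \<and> family I y \<in> families I"
    and "distinct xs" "a \<in> set xs"
  shows "elapsed I prev (upto_elem a (transform I \<rho> xs)) \<le>
    total_potential I \<rho> (upto_elem a xs)"
  using assms
proof (induction I \<rho> xs arbitrary: prev rule: transform.induct)
  case (2 I \<rho> x xs)
  define f where "f = family I x"
  define s where "s = setup_time I f"
  define B where "B = takeWhile (\<lambda>y. family I y = f) (x # xs)"
  define R where "R = dropWhile (\<lambda>y. family I y = f) (x # xs)"
  let ?zs = "upto_elem a (x # xs)"
  let ?p = "\<lambda>ys. sum_list (map (ptime I) ys)"
  let ?pot = "\<lambda>g ys. potential \<rho> (setup_time I g) (map (ptime I) (family_ops I g ys))"
  obtain Q R' where p: "pull I \<rho> f (?p B) R = (Q, R')" by fastforce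
  have tr: "transform I \<rho> (x # xs) = (B @ Q) @ transform I \<rho> R'"
    using p unfolding transform.simps Let_def f_def B_def R_def by simp
  have split: "x # xs = B @ R"
    unfolding B_def R_def by simp
  have rho: "0 \<le> \<rho>" using "2.prems"(1) real_sqrt_ge_zero[of 2] by linarith
  have fF: "f \<in> families I" using "2.prems"(4) by (simp add: f_def)
  have s0: "0 \<le> s" using "2.prems"(3) fF by (simp add: s_def)
  have Bf: "\<forall>y\<in>set B. family I y = f" unfolding B_def by (auto dest: set_takeWhileD)
  have Bne: "B \<noteq> []" by (simp add: B_def f_def)
  have BQf: "\<forall>y\<in>set (B @ Q). family I y = f" using Bf pull_family[OF p] by auto
  have distR: "distinct R"
    using "2.prems"(5) unfolding split by auto
  have distR': "distinct R'" by (rule pull_distinct[OF p distR])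
  have setR: "set R = set Q \<union> set R'" by (rule pull_set[OF p])
  have mem: "set (x # xs) = set B \<union> set R" unfolding split by simp
  have fam: "family_ops I f (x # xs) = (B @ Q) @ family_ops I f R'"
    unfolding split using pull_family_ops[OF p] family_ops_all[OF Bf] by simp
  have zs_sub: "set ?zs \<subseteq> set (x # xs)" using "2.prems"(6) by (rule set_upto_elem)
  have nonneg: "\<forall>t\<in>set (map (ptime I) (family_ops I g ?zs)). 0 \<le> t" for g
    using "2.prems"(4) zs_sub by (auto simp: set_family_ops simp del: upto_elem_Cons)
  have pot0: "0 \<le> ?pot g ?zs" if "g \<in> families I" for g
    using potential_nonneg[OF nonneg rho] "2.prems"(3) that by blast
  have tot: "total_potential I \<rho> ys = ?pot f ys + (\<Sum>g\<in>families I - {f}. ?pot g ys)" for ys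
    unfolding total_potential_def by (rule sum.remove[OF "2.prems"(2) fF])
  show ?case
  proof (cases "a \<in> set (B @ Q)")
    case True
    let ?ws = "family_ops I f ?zs"
    have af: "family I a = f" using True BQf by blast
    \<comment> \<open>\<open>B @ Q\<close> is an initial segment of the operations of family
      \<open>f\<close> in the input, so cutting it at \<open>a\<close> yields exactly those up to
      \<open>a\<close>; nothing from behind \<open>a\<close> is run before it.\<close>
    have ws: "upto_elem a (B @ Q) = ?ws"
      using family_ops_upto_elem[of a I "x # xs"] True
      unfolding af fam upto_elem_append[of a "B @ Q"] by simp
    have ne: "?ws \<noteq> []" unfolding ws[symmetric] by (simp add: upto_elem_def)
    have "upto_elem a (transform I \<rho> (x # xs)) = ?ws @ []"
      unfolding tr upto_elem_append[of a "B @ Q"] using True ws by simp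
    then have "elapsed I prev (upto_elem a (transform I \<rho> (x # xs))) \<le> s + ?p ?ws"
      using elapsed_batch[of ?ws I f prev "[]"] ne s0
      by (simp add: s_def set_family_ops del: upto_elem_Cons)
    also have "\<dots> \<le> s * (1 + \<rho>) + ?p ?ws" using s0 rho by (simp add: algebra_simps)
    also have "\<dots> \<le> ?pot f ?zs"
      unfolding s_def using potential_batch[OF _ nonneg rho] ne by blast
    also have "\<dots> \<le> total_potential I \<rho> ?zs"
      unfolding tot using sum_nonneg[of "families I - {f}" "\<lambda>g. ?pot g ?zs"] pot0 by fastforce
    finally show ?thesis .
  next
    case False
    have aR': "a \<in> set R'" using False "2.prems"(6) mem setR by auto
    have zs: "?zs = B @ upto_elem a R"
      unfolding split using False by (simp add: upto_elem_append)
    have tr_upto: "upto_elem a (transform I \<rho> (x # xs)) =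
        (B @ Q) @ upto_elem a (transform I \<rho> R')"
      unfolding tr upto_elem_append[of a "B @ Q"] using False by simp
    have "\<forall>y\<in>set R'. 0 \<le> ptime I y \<and> family I y \<in> families I"
      using "2.prems"(4) mem setR by blast
    then have IH: "elapsed I (Some f) (upto_elem a (transform I \<rho> R')) \<le>
        total_potential I \<rho> (upto_elem a R')"
      using "2.IH"[OF f_def B_def R_def refl, of "Some f"] p "2.prems"(1-3) distR' aR'
      by simp
    have other: "?pot g (upto_elem a R') = ?pot g ?zs" if "g \<noteq> f" for g
      using pull_upto_other[OF p aR' distR that] family_ops_none[of B I g] Bf that
      unfolding zs by auto
    \<comment> \<open>The potential released by \<open>f\<close> must cover a setup and the whole
      batch, including operations from behind \<open>a\<close>. The cases ask whether
      \<open>f\<close> has operations up to \<open>a\<close> left in \<open>R'\<close>.\<close>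
    have same: "s + ?p (B @ Q) + ?pot f (upto_elem a R') \<le> ?pot f ?zs"
    proof (cases "family_ops I f (upto_elem a R') = []")
      case True
      let ?ws = "family_ops I f ?zs"
      have ws: "?ws = B @ family_ops I f (upto_elem a R)"
        unfolding zs using family_ops_all[OF Bf] by simp
      have ws0: "0 \<le> ?p (family_ops I f (upto_elem a R))"
        using nonneg[of f] unfolding ws by (auto intro!: sum_list_nonneg)
      \<comment> \<open>\<open>Q\<close> may contain operations from behind \<open>a\<close>, which
        \<open>?ws\<close> misses. But once anything is pulled, the whole batch is shorter than
        \<open>\<rho> * s\<close>; otherwise it is just \<open>B\<close>, a part of
        \<open>?ws\<close>.\<close>
      have "?p (B @ Q) \<le> ?p ?ws + \<rho> * s"
      proof (cases "Q = []")
        case True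
        then show ?thesis using ws0 rho s0 unfolding ws by simp
      next
        case False
        then have "?p (B @ Q) \<le> \<rho> * s" using pull_bound[OF p] by (simp add: s_def)
        moreover have "0 \<le> ?p ?ws" using nonneg[of f] by (intro sum_list_nonneg) blast
        ultimately show ?thesis by linarith
      qed
      then have "s + ?p (B @ Q) \<le> s * (1 + \<rho>) + ?p ?ws" by (simp add: algebra_simps)
      also have "\<dots> \<le> ?pot f ?zs"
        unfolding s_def using potential_batch[OF _ nonneg[of f] rho] ws Bne
        by (metis Nil_is_append_conv map_is_Nil_conv)
      finally show ?thesis using True by simp
    next
      case False
      let ?us = "family_ops I f (upto_elem a R')"
      \<comment> \<open>Now the whole batch lies in front of \<open>a\<close> in the input, and
        together with the next operation of \<open>f\<close> it is long enough for
        \<open>potential_append\<close>.\<close>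
      note q = pull_upto_same[OF p aR' distR False]
      have ws: "family_ops I f ?zs = (B @ Q) @ ?us"
        unfolding zs using family_ops_all[OF Bf] q by simp
      have nn: "\<forall>t\<in>set (map (ptime I) (B @ Q)). 0 \<le> t"
        using nonneg[of f] unfolding ws by auto
      have "\<rho> * s \<le> ?p (B @ Q) + hd (map (ptime I) ?us)"
        using q False by (simp add: s_def hd_map)
      then show ?thesis
        using potential_append[of "map (ptime I) (B @ Q)" "map (ptime I) ?us" \<rho> s]
          Bne False nn "2.prems"(1) s0
        unfolding ws map_append s_def by simp
    qed
    have "elapsed I prev (upto_elem a (transform I \<rho> (x # xs))) \<le>
        s + ?p (B @ Q) + elapsed I (Some f) (upto_elem a (transform I \<rho> R'))"
      unfolding tr_upto s_def using BQf Bne s0 by (intro elapsed_batch) (auto simp: s_def)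
    also have "\<dots> \<le> s + ?p (B @ Q) + total_potential I \<rho> (upto_elem a R')"
      using IH by simp
    also have "\<dots> = s + ?p (B @ Q) + ?pot f (upto_elem a R')
        + (\<Sum>g\<in>families I - {f}. ?pot g ?zs)"
      unfolding tot using other by (simp del: upto_elem_Cons)
    also have "\<dots> \<le> total_potential I \<rho> ?zs"
      unfolding tot using same by linarith
    finally show ?thesis .
  qed
qed simp

subsection \<open>Comparison with the relaxed schedule\<close>

lemma set_induced_ops: "set (induced_ops \<pi>) = {a. Op a \<in> set \<pi>}"
  by (induction \<pi> rule: induced_ops.induct) auto

lemma distinct_induced_ops: "distinct \<pi> \<Longrightarrow> distinct (induced_ops \<pi>)"
  by (induction \<pi> rule: induced_ops.induct) (auto simp: set_induced_ops)

lemma induced_ops_upto_elem: "induced_ops (upto_elem (Op a) \<pi>) = upto_elem a (induced_ops \<pi>)"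
  by (induction \<pi> rule: induced_ops.induct) auto

text \<open>Regroups relaxed time by family, for a comparison with \<open>total_potential\<close>
  summand by summand.\<close>

lemma sum_list_item_time:
  assumes "distinct \<pi>" "finite F" "\<forall>f. Setup f \<in> set \<pi> \<longrightarrow> f \<in> F"
    and "\<forall>a. Op a \<in> set \<pi> \<longrightarrow> family I a \<in> F"
  shows "sum_list (map (item_time I) \<pi>) =
    (\<Sum>f\<in>F. (if Setup f \<in> set \<pi> then setup_time I f else 0)
      + sum_list (map (ptime I) (family_ops I f (induced_ops \<pi>))))"
  using assms
proof (induction \<pi> rule: induced_ops.induct)
  case (2 a \<pi>)
  have "(\<Sum>f\<in>F. (if Setup f \<in> set (Op a # \<pi>) then setup_time I f else 0)
      + sum_list (map (ptime I) (family_ops I f (induced_ops (Op a # \<pi>))))) =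
    (\<Sum>f\<in>F. (if family I a = f then ptime I a else 0)
      + ((if Setup f \<in> set \<pi> then setup_time I f else 0)
        + sum_list (map (ptime I) (family_ops I f (induced_ops \<pi>)))))"
    by (intro sum.cong) auto
  also have "\<dots> = ptime I a + sum_list (map (item_time I) \<pi>)"
    using 2 by (simp add: sum.distrib)
  finally show ?case by simp
next
  case (3 g \<pi>)
  have "(\<Sum>f\<in>F. (if Setup f \<in> set (Setup g # \<pi>) then setup_time I f else 0)
      + sum_list (map (ptime I) (family_ops I f (induced_ops (Setup g # \<pi>))))) =
    (\<Sum>f\<in>F. (if g = f then setup_time I g else 0)
      + ((if Setup f \<in> set \<pi> then setup_time I f else 0)
        + sum_list (map (ptime I) (family_ops I f (induced_ops \<pi>)))))"
    using 3(2) by (intro sum.cong) auto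
  also have "\<dots> = setup_time I g + sum_list (map (item_time I) \<pi>)"
    using 3 by (simp add: sum.distrib)
  finally show ?case by simp
qed simp

text \<open>Forgets the correction \<open>- \<rho> / 2 * t\<close>. The conditional matters because
  the relaxed schedule may not yet have run the setup of a family without operations so far.\<close>

lemma potential_le:
  assumes "\<forall>t\<in>set ts. 0 \<le> t" "0 \<le> \<rho>"
  shows "potential \<rho> s ts \<le> (1 + \<rho>) * ((if ts = [] then 0 else s) + sum_list ts)"
  using assms by (cases ts) (auto simp: add.assoc)

lemma total_potential_le_relaxed_completion:
  assumes "valid_instance I" "relaxed_schedule I \<pi>" "0 \<le> \<rho>" "a \<in> operations I"
  shows "total_potential I \<rho> (upto_elem a (induced_ops \<pi>)) \<le>
    (1 + \<rho>) * relaxed_completion I \<pi> a"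
proof -
  define W where "W = upto_elem (Op a) \<pi>"
  have set\<pi>: "set \<pi> = Op ` operations I \<union> Setup ` families I"
    and dist: "distinct \<pi>"
    and setups: "\<forall>b\<in>operations I. Setup (family I b) \<in> set (upto_elem (Op b) \<pi>)"
    using assms(2) by (auto simp: relaxed_schedule_def)
  have W_sub: "set W \<subseteq> set \<pi>" unfolding W_def using set\<pi> assms(4) by (intro set_upto_elem) auto
  have W_ops: "0 \<le> ptime I b \<and> family I b \<in> families I \<and> Setup (family I b) \<in> set W"
    if "Op b \<in> set W" for b
  proof -
    have b: "b \<in> operations I" using that W_sub set\<pi> by auto
    \<comment> \<open>The prefix up to \<open>b\<close> contains this setup and lies within the
      prefix up to \<open>a\<close>.\<close>
    have "Setup (family I b) \<in> set W"
      using setups b set_upto_elem_mono[of "Op b" "Op a" \<pi>] that unfolding W_def by blast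
    then show ?thesis using b assms(1) by (auto simp: valid_instance_def)
  qed
  have "relaxed_completion I \<pi> a =
    (\<Sum>f\<in>families I. (if Setup f \<in> set W then setup_time I f else 0)
      + sum_list (map (ptime I) (family_ops I f (induced_ops W))))"
    unfolding relaxed_completion_def W_def[symmetric]
  proof (rule sum_list_item_time)
    show "distinct W" unfolding W_def by (rule distinct_upto_elem[OF dist])
    show "finite (families I)" using assms(1) by (simp add: valid_instance_def)
  qed (use W_sub set\<pi> W_ops in auto)
  then have "(1 + \<rho>) * relaxed_completion I \<pi> a =
    (\<Sum>f\<in>families I. (1 + \<rho>) * ((if Setup f \<in> set W then setup_time I f else 0)
      + sum_list (map (ptime I) (family_ops I f (induced_ops W)))))"
    by (simp add: sum_distrib_left)
  moreover have "total_potential I \<rho> (induced_ops W) \<le> \<dots>"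
    unfolding total_potential_def
  proof (rule sum_mono)
    fix f assume f: "f \<in> families I"
    let ?ws = "family_ops I f (induced_ops W)"
    have nn: "\<forall>t\<in>set (map (ptime I) ?ws). 0 \<le> t"
      using W_ops by (auto simp: set_family_ops set_induced_ops)
    \<comment> \<open>A family with operations up to \<open>a\<close> has paid its setup there; for
      any other family the left conditional below is 0.\<close>
    have "Setup f \<in> set W" if "?ws \<noteq> []"
    proof -
      have "hd ?ws \<in> set ?ws" using that by simp
      then show ?thesis using W_ops[of "hd ?ws"] by (auto simp: set_family_ops set_induced_ops)
    qed
    moreover have "0 \<le> setup_time I f" using assms(1) f by (simp add: valid_instance_def)
    ultimately have "(if map (ptime I) ?ws = [] then 0 else setup_time I f) \<le>
        (if Setup f \<in> set W then setup_time I f else 0)"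
      by auto
    then have "(1 + \<rho>) * ((if map (ptime I) ?ws = [] then 0 else setup_time I f)
          + sum_list (map (ptime I) ?ws)) \<le>
        (1 + \<rho>) * ((if Setup f \<in> set W then setup_time I f else 0)
          + sum_list (map (ptime I) ?ws))"
      using assms(3) by (intro mult_left_mono add_right_mono) auto
    then show "potential \<rho> (setup_time I f) (map (ptime I) ?ws) \<le>
        (1 + \<rho>) * ((if Setup f \<in> set W then setup_time I f else 0)
          + sum_list (map (ptime I) ?ws))"
      using potential_le[OF nn assms(3), of "setup_time I f"] by linarith
  qed
  ultimately show ?thesis unfolding W_def induced_ops_upto_elem by simp
qed

section \<open>From single operations to the total cost\<close>

lemma completion_Transform_le:
  assumes "valid_instance I" "relaxed_schedule I \<pi>" "sqrt 2 \<le> \<rho>" "a \<in> operations I"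
  shows "completion I (Transform I \<rho> \<pi>) a \<le> (1 + \<rho>) * relaxed_completion I \<pi> a"
proof -
  have ops: "set (induced_ops \<pi>) = operations I" and dist: "distinct (induced_ops \<pi>)"
    using assms(2) by (auto simp: relaxed_schedule_def set_induced_ops distinct_induced_ops)
  have "0 \<le> \<rho>" using assms(3) real_sqrt_ge_zero[of 2] by linarith
  then have "total_potential I \<rho> (upto_elem a (induced_ops \<pi>)) \<le>
      (1 + \<rho>) * relaxed_completion I \<pi> a"
    using assms by (intro total_potential_le_relaxed_completion)
  moreover have "completion I (Transform I \<rho> \<pi>) a \<le>
      total_potential I \<rho> (upto_elem a (induced_ops \<pi>))"
    unfolding completion_def Transform_def using assms(1,3,4) ops dist
    by (intro elapsed_transform_le) (auto simp: valid_instance_def)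
  ultimately show ?thesis by linarith
qed

theorem theorem1:
  fixes I :: "('o, 'f) setup_instance" and \<pi> :: "('o, 'f) item list" and \<rho> c :: real
  assumes "valid_instance I"
    and "relaxed_schedule I \<pi>"
    and "\<rho> \<ge> sqrt 2"
    and "relaxed_cost I \<pi> \<le> c * OPT I"
  shows "cost I (Transform I \<rho> \<pi>) \<le> (1 + \<rho>) * c * OPT I"
proof -
  have rho: "0 \<le> 1 + \<rho>" using assms(3) real_sqrt_ge_zero[of 2] by linarith
  have "cost I (Transform I \<rho> \<pi>) \<le>
      (\<Sum>j\<in>jobs I. weight I j * ((1 + \<rho>) * Max (relaxed_completion I \<pi> ` j)))"
    unfolding cost_def
  proof (intro sum_mono mult_left_mono)
    fix j assume j: "j \<in> jobs I"
    then show "0 \<le> weight I j" using assms(1) by (simp add: valid_instance_def)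
    have sub: "j \<subseteq> operations I" using j by (auto simp: operations_def)
    have "finite j" using sub assms(1) finite_subset by (auto simp: valid_instance_def)
    moreover have "j \<noteq> {}" using j assms(1) by (auto simp: valid_instance_def partition_on_def)
    \<comment> \<open>The last operation of \<open>j\<close> may differ between the two schedules,
      so every operation is compared with the relaxed maximum.\<close>
    moreover have "completion I (Transform I \<rho> \<pi>) a \<le>
        (1 + \<rho>) * Max (relaxed_completion I \<pi> ` j)" if "a \<in> j" for a
    proof -
      have "completion I (Transform I \<rho> \<pi>) a \<le> (1 + \<rho>) * relaxed_completion I \<pi> a"
        using sub that by (intro completion_Transform_le assms) auto
      also have "\<dots> \<le> (1 + \<rho>) * Max (relaxed_completion I \<pi> ` j)"
        using rho \<open>finite j\<close> that by (intro mult_left_mono) auto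
      finally show ?thesis .
    qed
    ultimately show "Max (completion I (Transform I \<rho> \<pi>) ` j) \<le>
        (1 + \<rho>) * Max (relaxed_completion I \<pi> ` j)"
      by simp
  qed
  also have "\<dots> = (1 + \<rho>) * relaxed_cost I \<pi>"
    by (simp add: relaxed_cost_def sum_distrib_left mult.left_commute)
  also have "\<dots> \<le> (1 + \<rho>) * (c * OPT I)" using assms(4) rho by (rule mult_left_mono)
  finally show ?thesis by (simp add: mult.assoc)
qed

end
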